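(* Let $d \ge 0$ be an integer, let $\mathcal{U}$ be an $M$-dimensional subspace of $\mathcal{C}[-1,1]$ consisting of polynomials of degree at most $d$, and let $(u_1,\ldots,u_M)$ be a basis for $\mathcal{U}$. Let $v_1,\ldots,v_K$ be distinct points in $[-1,1]$. Let $L > d$ be an integer, let $w_1 > \cdots > w_L$ denote the Chebyshev zeros $w_\ell = \cos\left(\pi(\ell-1/2)/L\right)$, $\ell \in \{1,\ldots,L\}$, and let $\rho = \cos\left((\pi d)/(2L)\right)^{-1} \ge 1$. Then $$ \lambda(\mathcal{U}) \;\le\; \rho \times \min_{A} \; \max_{1 \le \ell \le L} \; \sum_{k=1}^K \left| \sum_{m=1}^M A_{m,k}\, u_m(w_\ell) \right|, $$ where the minimum is taken over all matrices $A \in \mathbb{R}^{M \times K}$ satisfying $$ \sum_{k=1}^K A_{m,k}\, u_{m'}(v_k) = \delta_{m,m'} \quad \text{for all } m,m' \in \{1,\ldots,M\}. $$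
   Context: $\mathcal{C}[-1,1]$ is the space of real-valued continuous functions on $[-1,1]$ with the norm $\|f\|_\infty = \max_{x\in[-1,1]}|f(x)|$. A projection from $\mathcal{C}[-1,1]$ onto a finite-dimensional subspace $\mathcal{U}$ is a linear map $P$ from $\mathcal{C}[-1,1]$ onto $\mathcal{U}$ such that $P(u)=u$ for all $u\in\mathcal{U}$; its norm is $\|P\|_{\infty\to\infty} = \max_{\|f\|_\infty\le 1}\|P(f)\|_\infty$. The projection constant of $\mathcal{U}$ (relative to $\mathcal{C}[-1,1]$) is $\lambda(\mathcal{U}) := \min_P \|P\|_{\infty\to\infty}$, the minimum being over all (bounded) projections $P$ from $\mathcal{C}[-1,1]$ onto $\mathcal{U}$. $\delta_{m,m'}$ is the Kronecker delta. By convention, a minimum over an empty set is $+\infty$. *)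

theory Defs
  imports "HOL-Analysis.Analysis" "HOL-Computational_Algebra.Polynomial"
begin

text \<open>The interval \<open>[-1,1]\<close> is made into a type, with the metric inherited from the reals, so that
  the type of bounded continuous functions on it is the normed space \<open>C[-1,1]\<close>.\<close>

typedef segment = "{-1..1::real}"
  morphisms coord Point
  by (rule exI[of _ 0]) simp

instantiation segment :: metric_space
begin

definition dist_segment :: "segment \<Rightarrow> segment \<Rightarrow> real"
  where "dist_segment x y = dist (coord x) (coord y)"

definition uniformity_segment :: "(segment \<times> segment) filter"
  where "uniformity_segment = (INF e\<in>{0<..}. principal {(x, y). dist x y < e})"

definition open_segment :: "segment set \<Rightarrow> bool"
  where "open_segment U \<longleftrightarrow> (\<forall>x\<in>U. eventually (\<lambda>(x', y). x' = x \<longrightarrow> y \<in> U) uniformity)"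

instance
proof
  fix x y z :: segment
  show "dist x y = 0 \<longleftrightarrow> x = y"
    by (simp add: dist_segment_def coord_inject)
  show "dist x y \<le> dist x z + dist y z"
    unfolding dist_segment_def by (rule dist_triangle2)
qed (simp_all add: uniformity_segment_def open_segment_def)

end

type_synonym C_segment = "segment \<Rightarrow>\<^sub>C real"

lemma continuous_on_coord: "continuous_on UNIV coord"
  unfolding continuous_on_iff dist_segment_def by auto

lemma continuous_on_Point: "continuous_on {-1..1} Point"
  unfolding continuous_on_iff dist_segment_def by (auto simp: Point_inverse)

lemma compact_UNIV_segment: "compact (UNIV :: segment set)"
proof -
  have "Point ` {-1..1} = UNIV"
    by (metis coord coord_inverse imageI UNIV_eq_I)
  then show ?thesis
    using compact_continuous_image[OF continuous_on_Point compact_Icc] by simp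
qed

text \<open>By compactness the boundedness requirement in the function type is vacuous, and its supremum
  norm is a maximum.\<close>

lemma bcontfun_segment_iff:
  fixes f :: "segment \<Rightarrow> real"
  shows "f \<in> bcontfun \<longleftrightarrow> continuous_on UNIV f"
  using compact_continuous_image[OF _ compact_UNIV_segment, of f]
  by (auto simp: bcontfun_def dest: compact_imp_bounded)

lemma continuous_on_segment_iff:
  fixes f :: "segment \<Rightarrow> real"
  shows "continuous_on UNIV f \<longleftrightarrow> continuous_on {-1..1} (\<lambda>x. f (Point x))"
proof
  assume "continuous_on UNIV f"
  then show "continuous_on {-1..1} (\<lambda>x. f (Point x))"
    by (rule continuous_on_compose2[OF _ continuous_on_Point]) simp
next
  assume "continuous_on {-1..1} (\<lambda>x. f (Point x))"
  then have "continuous_on UNIV (\<lambda>x. f (Point (coord x)))"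
    by (rule continuous_on_compose2[OF _ continuous_on_coord]) (use coord in auto)
  then show "continuous_on UNIV f"
    by (simp add: coord_inverse)
qed

lemma norm_C_segment_max:
  fixes f :: C_segment
  shows "\<exists>x. norm f = \<bar>f x\<bar> \<and> (\<forall>y. \<bar>f y\<bar> \<le> \<bar>f x\<bar>)"
proof -
  have "continuous_on UNIV (\<lambda>x. \<bar>f x\<bar>)"
    using bcontfun_segment_iff[of f] apply_bcontfun[of f] by (intro continuous_on_rabs) simp
  then obtain x where x: "\<And>y. \<bar>f y\<bar> \<le> \<bar>f x\<bar>"
    using continuous_attains_sup[OF compact_UNIV_segment, of "\<lambda>x. \<bar>f x\<bar>"] by auto
  have "norm f \<le> \<bar>f x\<bar>"
    using x by (intro norm_bound) simp
  moreover have "\<bar>f x\<bar> \<le> norm f"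
    using norm_bounded[of f x] by simp
  ultimately show ?thesis
    using x by (intro exI[of _ x]) auto
qed

definition is_projection_onto :: "(C_segment \<Rightarrow>\<^sub>L C_segment) \<Rightarrow> C_segment set \<Rightarrow> bool"
  where "is_projection_onto P U \<longleftrightarrow>
    range (blinfun_apply P) = U \<and> (\<forall>u\<in>U. blinfun_apply P u = u)"

text \<open>Minima are rendered as infima in the extended reals: they coincide whenever the minimum is
  attained, and the infimum of the empty set is \<open>\<infinity>\<close>. The norm of a bounded linear map
  is its operator norm.\<close>

definition projection_constant :: "C_segment set \<Rightarrow> ereal"
  where "projection_constant U = (INF P\<in>{P. is_projection_onto P U}. ereal (norm P))"

definition polynomial_of_degree_le :: "nat \<Rightarrow> C_segment \<Rightarrow> bool"
  where "polynomial_of_degree_le d f \<longleftrightarrow>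
    (\<exists>p :: real poly. degree p \<le> d \<and> (\<forall>x. f x = poly p (coord x)))"

definition is_basis :: "nat \<Rightarrow> (nat \<Rightarrow> 'a::real_vector) \<Rightarrow> 'a set \<Rightarrow> bool"
  where "is_basis M u U \<longleftrightarrow>
    inj_on u {1..M} \<and> independent (u ` {1..M}) \<and> span (u ` {1..M}) = U"

definition chebyshev_zero :: "nat \<Rightarrow> nat \<Rightarrow> segment"
  where "chebyshev_zero L l = Point (cos (pi * (real l - 1/2) / real L))"

lemma coord_chebyshev_zero: "coord (chebyshev_zero L l) = cos (pi * (real l - 1/2) / real L)"
  by (simp add: chebyshev_zero_def Point_inverse)

text \<open>An \<open>M \<times> K\<close> matrix is a function of two indices; only its values at indices in
  \<open>{1..M}\<close> and \<open>{1..K}\<close> matter.\<close>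

definition biorthogonal_matrices ::
    "nat \<Rightarrow> nat \<Rightarrow> (nat \<Rightarrow> C_segment) \<Rightarrow> (nat \<Rightarrow> segment) \<Rightarrow> (nat \<Rightarrow> nat \<Rightarrow> real) set"
  where "biorthogonal_matrices M K u v =
    {A. \<forall>m\<in>{1..M}. \<forall>m'\<in>{1..M}. (\<Sum>k=1..K. A m k * u m' (v k)) = (if m = m' then 1 else 0)}"

lemma inverse_cos_ge_1:
  fixes d L :: nat
  assumes "L > d"
  shows "inverse (cos (pi * real d / (2 * real L))) \<ge> 1"
proof -
  have "pi * real d / (2 * real L) < pi / 2"
    using assms by (simp add: field_simps)
  then have "cos (pi * real d / (2 * real L)) > 0"
    by (intro cos_gt_zero_pi) (simp_all add: order_less_le_trans[of _ 0])
  then show ?thesis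
    by (simp add: one_le_inverse)
qed

end

theory Submission
  imports Defs
begin

text \<open>A matrix \<open>A\<close> satisfying the constraints gives the projection
  \<open>P f = (\<Sum>k. f (v k) g\<^sub>k)\<close> with \<open>g\<^sub>k = (\<Sum>m. A m k u\<^sub>m)\<close>, whose norm is at most
  the maximum of \<open>(\<Sum>k. \<bar>g\<^sub>k x\<bar>)\<close> over \<open>x\<close>. Choosing signs at a point \<open>x\<close> turns this sum into the value of a
  polynomial of degree at most \<open>d\<close>, so it remains to bound the maximum norm of such a polynomial by \<open>\<rho>\<close>
  times its maximum over the Chebyshev zeros (Ehlich and Zeller). This follows from M. Riesz's
  comparison lemma: around a point \<open>\<theta>\<close> where \<open>p (cos \<theta>)\<close> attains its maximum modulus \<open>1\<close>, it decreases no
  faster than the cosine of frequency \<open>d\<close>, and some node lies within \<open>\<pi> / (2 L)\<close> of \<open>\<theta>\<close>. A violation of the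
  comparison lemma would give a trigonometric polynomial of degree \<open>d\<close> with more than \<open>2 d\<close> zeros
  in a period.\<close>

section \<open>Counting zeros of trigonometric polynomials\<close>

lemma sign_alternation_zeros:
  fixes f :: "real \<Rightarrow> real" and x :: "nat \<Rightarrow> real"
  assumes cont: "continuous_on UNIV f"
    and mono: "\<And>j. j < n \<Longrightarrow> x j < x (Suc j)"
    and alt: "\<And>j. j \<le> n \<Longrightarrow> (-1) ^ j * f (x j) > 0"
  shows "\<exists>Z. finite Z \<and> card Z = n \<and> Z \<subseteq> {x 0<..<x n} \<and> (\<forall>z\<in>Z. f z = 0)"
  using mono alt
proof (induction n)
  case 0
  show ?case by (intro exI[of _ "{}"]) simp
next
  case (Suc n)
  then obtain Z where Z: "finite Z" "card Z = n" "Z \<subseteq> {x 0<..<x n}" "\<forall>z\<in>Z. f z = 0"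
    by (metis less_Suc_eq le_Suc_eq)
  have lt: "x n < x (Suc n)" using Suc.prems(1) by simp
  have s: "(-1) ^ n * f (x n) > 0" "(-1) ^ n * f (x (Suc n)) < 0"
    using Suc.prems(2)[of n] Suc.prems(2)[of "Suc n"] by simp_all
  have "\<exists>z\<ge>x n. z \<le> x (Suc n) \<and> (-1) ^ n * f z = 0"
    using s lt by (intro IVT2') (auto intro!: continuous_intros continuous_on_subset[OF cont])
  then obtain z where z: "x n \<le> z" "z \<le> x (Suc n)" "f z = 0" by auto
  moreover have "z \<noteq> x n" "z \<noteq> x (Suc n)" using s z by auto
  moreover have "x 0 \<le> x n"
    using lift_Suc_mono_le[of "\<lambda>j. x (min j n)" 0 n] Suc.prems(1)
    by (force simp: min_def less_eq_real_def not_less_eq_eq le_Suc_eq)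
  ultimately have "x n < z" "z < x (Suc n)" "x 0 \<le> x n" by auto
  then show ?case
    using Z z lt by (intro exI[of _ "insert z Z"]) (fastforce simp: card_insert_if)
qed

text \<open>With \<open>z = cis t\<close>, \<open>cos t\<close> is \<open>(z + 1/z) / 2\<close>, so
  multiplying by \<open>z ^ d\<close> clears all negative powers of \<open>z\<close>. Zeros in
  \<open>t\<close> can then be counted as roots of an algebraic polynomial.\<close>

lemma poly_cos_eq_cis:
  fixes p :: "real poly"
  assumes "degree p \<le> d"
  obtains q :: "complex poly"
  where "degree q \<le> 2 * d"
    and "\<And>t. poly q (cis t) = cis (real d * t) * of_real (poly p (cos t))"
proof
  define q where
    \<comment> \<open>The factor \<open>[:1/2, 0, 1/2:]\<close> takes the value
      \<open>(1 + z^2) / 2 = z * cos t\<close> at \<open>z = cis t\<close>; the monomial raises each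
      summand to the common factor \<open>z ^ d\<close>.\<close>
    "q = (\<Sum>i\<le>d. smult (of_real (coeff p i)) (monom 1 (d - i) * [:1/2, 0, 1/2:] ^ i :: complex poly))"
  have "degree (smult (of_real (coeff p i)) (monom 1 (d - i) * [:1/2, 0, 1/2:] ^ i :: complex poly)) \<le> 2 * d"
    if "i \<le> d" for i
  proof -
    have "degree (monom 1 (d - i) * [:1/2, 0, 1/2:] ^ i :: complex poly) \<le> (d - i) + 2 * i"
      using degree_mult_le[of "monom 1 (d - i)" "[:1/2, 0, 1/2:] ^ i :: complex poly"]
        degree_power_le[of "[:1/2, 0, 1/2:] :: complex poly" i]
      by (simp add: degree_monom_eq)
    also have "\<dots> \<le> 2 * d" using that by simp
    finally show ?thesis by (rule order.trans[OF degree_smult_le])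
  qed
  then show "degree q \<le> 2 * d"
    unfolding q_def by (intro degree_sum_le) auto
  fix t
  have sq: "poly [:1/2, 0, 1/2:] (cis t) = cis t * of_real (cos t)"
  proof -
    have "cis t * cis (- t) = 1" by (simp add: cis_mult)
    moreover have "complex_of_real (cos t) = (cis t + cis (- t)) / 2"
      by (simp add: complex_eq_iff)
    ultimately show ?thesis by (simp add: field_simps)
  qed
  have pc: "poly p (cos t) = (\<Sum>i\<le>d. coeff p i * cos t ^ i)"
    unfolding poly_altdef using assms
    by (intro sum.mono_neutral_left) (auto simp: coeff_eq_0)
  have "poly q (cis t) = (\<Sum>i\<le>d. of_real (coeff p i) * (cis t ^ (d - i) * (cis t * of_real (cos t)) ^ i))"
    unfolding q_def poly_sum poly_smult poly_mult poly_power sq poly_monom by simp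
  also have "\<dots> = (\<Sum>i\<le>d. cis t ^ d * of_real (coeff p i * cos t ^ i))"
  proof (intro sum.cong refl)
    fix i assume "i \<in> {..d}"
    then have "cis t ^ d = cis t ^ (d - i) * cis t ^ i" by (simp flip: power_add)
    then show "of_real (coeff p i) * (cis t ^ (d - i) * (cis t * of_real (cos t)) ^ i) =
        cis t ^ d * of_real (coeff p i * cos t ^ i)"
      by (simp add: power_mult_distrib)
  qed
  finally show "poly q (cis t) = cis (real d * t) * of_real (poly p (cos t))"
    by (simp add: pc sum_distrib_left Complex.DeMoivre)
qed

text \<open>Up to the unimodular factor \<open>cis (real d * t)\<close>, the difference of the two
  sides is a polynomial of degree at most \<open>2 * d\<close> in \<open>cis t\<close>, and
  \<open>cis\<close> is injective on an open interval of length \<open>2 * pi\<close>. The point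
  \<open>t0\<close> guarantees that this polynomial is nonzero.\<close>

lemma cos_minus_poly_cos_zeros:
  fixes p :: "real poly"
  assumes deg: "degree p \<le> d"
    and ne: "cos (real d * (t0 - c)) \<noteq> poly p (cos t0)"
    and Z: "finite Z" "Z \<subseteq> {c<..<c + 2 * pi}"
    and zero: "\<And>t. t \<in> Z \<Longrightarrow> cos (real d * (t - c)) = poly p (cos t)"
  shows "card Z \<le> 2 * d"
proof -
  obtain q where q: "degree q \<le> 2 * d"
    "\<And>t. poly q (cis t) = cis (real d * t) * of_real (poly p (cos t))"
    using poly_cos_eq_cis[OF deg] by blast
  \<comment> \<open>The first two terms represent the cosine:
    \<open>z ^ d * cos (d * (t - c))\<close> is half of
    \<open>cis (- d * c) * z ^ (2 * d) + cis (d * c)\<close>.\<close>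
  define r where
    "r = monom (cis (- real d * c) / 2) (2 * d) + [:cis (real d * c) / 2:] - q"
  have deg_r: "degree r \<le> 2 * d"
    unfolding r_def using q(1)
    by (intro degree_diff_le degree_add_le degree_monom_le) simp_all
  have r: "poly r (cis t) = cis (real d * t) * of_real (cos (real d * (t - c)) - poly p (cos t))" for t
  proof -
    let ?e = "cis (real d * t)" and ?w = "cis (real d * (t - c))" and ?w' = "cis (- (real d * (t - c)))"
    have m: "?e * cis (- real d * c) = ?w" and k: "cis (real d * c) = ?e * ?w'"
      by (simp_all add: cis_mult algebra_simps)
    have c: "complex_of_real (cos (real d * (t - c))) = (?w + ?w') / 2"
      by (simp add: complex_eq_iff)
    have "cis t ^ (2 * d) = ?e * ?e"
      by (simp add: Complex.DeMoivre cis_mult algebra_simps)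
    then have "poly r (cis t) = (?e * cis (- real d * c)) * ?e / 2 + cis (real d * c) / 2
        - ?e * of_real (poly p (cos t))"
      unfolding r_def poly_diff poly_add poly_monom q(2) by (simp add: mult_ac)
    also have "\<dots> = ?e * ((?w + ?w') / 2 - of_real (poly p (cos t)))"
      unfolding m unfolding k by (simp add: algebra_simps add_divide_distrib)
    finally show ?thesis unfolding of_real_diff c .
  qed
  have "r \<noteq> 0" using r[of t0] ne by auto
  have "inj_on cis Z"
  proof (rule inj_onI)
    fix s t assume st: "s \<in> Z" "t \<in> Z" "cis s = cis t"
    then have "cis (s - t) = 1" by (simp add: cis_divide[symmetric])
    then have "cos (s - t) = 1" by (simp add: complex_eq_iff)
    then obtain n :: int where n: "s - t = real_of_int n * 2 * pi"
      by (auto simp: cos_one_2pi_int)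
    have "s \<in> {c<..<c + 2 * pi}" "t \<in> {c<..<c + 2 * pi}" using st Z(2) by blast+
    then have "\<bar>s - t\<bar> < 2 * pi" by (auto simp: abs_less_iff)
    then have "\<bar>real_of_int n\<bar> < 1" by (simp add: n abs_mult)
    then have "n = 0" by linarith
    then show "s = t" using n by simp
  qed
  then have "card Z = card (cis ` Z)" by (simp add: card_image)
  also have "\<dots> \<le> card {z. poly r z = 0}"
    using zero by (intro card_mono poly_roots_finite \<open>r \<noteq> 0\<close>) (auto simp: r)
  also have "\<dots> \<le> degree r" by (intro card_poly_roots_bound \<open>r \<noteq> 0\<close>)
  finally show ?thesis using deg_r by simp
qed

section \<open>M. Riesz's comparison lemma\<close>

text \<open>Otherwise cosine minus polynomial has signs +, -, + at \<open>c\<close>,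
  \<open>a\<close>, \<open>b\<close>. The strict bound makes the signs go on alternating at the
  extrema \<open>c + j * pi / d\<close> of the cosine for \<open>j = 1, ..., 2 * d\<close>. These
  \<open>2 * d + 3\<close> points enclose \<open>2 * d + 2\<close> zeros inside one period.\<close>

lemma poly_cos_crosses_cos_once:
  fixes p :: "real poly"
  assumes d: "d > 0" "degree p \<le> d"
    and bound: "\<And>t. \<bar>poly p (cos t)\<bar> < 1"
    and ord: "c < a" "a < b" "b < c + pi / real d"
    and a: "poly p (cos a) > cos (real d * (a - c))"
  shows "poly p (cos b) \<ge> cos (real d * (b - c))"
proof (rule ccontr)
  assume b: "\<not> ?thesis"
  define f where "f t = cos (real d * (t - c)) - poly p (cos t)" for t
  \<comment> \<open>The shift by 2 makes room for \<open>a\<close> and \<open>b\<close> before the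
    extremum \<open>c + pi / d\<close>; being even, it preserves the parity of the sign.\<close>
  define x where "x j = (if j = 0 then c else if j = 1 then a else if j = 2 then b
    else c + real (j - 2) * pi / real d)" for j :: nat
  have cont: "continuous_on UNIV f"
    unfolding f_def by (intro continuous_intros)
  have mono: "x j < x (Suc j)" for j
  proof -
    consider "j = 0" | "j = 1" | "j = 2" | "j \<ge> 3" by linarith
    then show ?thesis
    proof cases
      case 4
      then show ?thesis using d by (simp add: x_def Suc_diff_le field_simps)
    qed (use ord in \<open>auto simp: x_def\<close>)
  qed
  have alt: "(-1) ^ j * f (x j) > 0" for j
  proof -
    consider "j = 0" | "j = 1" | "j = 2" | "j \<ge> 3" by linarith
    then show ?thesis
    proof cases
      case 4
      then have "cos (real d * (x j - c)) = (-1) ^ (j - 2)"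
        using d by (simp add: x_def cos_npi del: of_nat_diff)
      also have "\<dots> = (-1) ^ j" using 4 by (simp add: minus_one_power_iff)
      finally have "f (x j) = (-1) ^ j - poly p (cos (x j))" by (simp add: f_def)
      then show ?thesis using bound[of "x j"]
        by (cases "even j") (auto simp: abs_less_iff)
    qed (use a b bound[of c] in \<open>auto simp: x_def f_def abs_less_iff\<close>)
  qed
  obtain Z where Z: "finite Z" "card Z = 2 * d + 2" "Z \<subseteq> {x 0<..<x (2 * d + 2)}" "\<forall>z\<in>Z. f z = 0"
    using sign_alternation_zeros[of f "2 * d + 2" x] cont mono alt by blast
  have "x (2 * d + 2) = c + 2 * pi" using d by (simp add: x_def)
  then have "card Z \<le> 2 * d"
    using Z alt[of 0] d(2)
    by (intro cos_minus_poly_cos_zeros[of p d c c]) (auto simp: f_def x_def)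
  then show False using Z(2) by simp
qed

text \<open>The crossing lemma needs strict inequalities, which fail at \<theta>, where the two
  functions touch. A violation at \<open>\<theta> + \<delta>\<close> is strict, so it survives a
  small perturbation to which that lemma applies.\<close>

lemma Riesz_comparison_right:
  fixes p :: "real poly"
  assumes deg: "degree p \<le> d"
    and bound: "\<And>t. \<bar>poly p (cos t)\<bar> \<le> 1"
    and top: "poly p (cos \<theta>) = 1"
    and \<delta>: "0 \<le> \<delta>" "real d * \<delta> < pi / 2"
  shows "poly p (cos (\<theta> + \<delta>)) \<ge> cos (real d * \<delta>)"
proof (rule ccontr)
  assume neg: "\<not> ?thesis"
  have "d > 0"
  proof (rule ccontr)
    assume "\<not> d > 0"
    then obtain e where "p = [:e:]" using deg by (auto elim: degree_eq_zeroE)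
    then show False using neg top \<open>\<not> d > 0\<close> by simp
  qed
  have "\<delta> > 0" using \<delta> neg top by (cases "\<delta> = 0") auto
  \<comment> \<open>Truncation at 0 ensures that scaling by a factor \<open>s < 1\<close> keeps the
    value at most \<open>y\<close>, even if the polynomial is negative there.\<close>
  define y where "y = max 0 (poly p (cos (\<theta> + \<delta>)))"
  have "cos (real d * \<delta>) > 0" using \<delta> by (intro cos_gt_zero_pi) (auto simp: less_le_trans[of _ 0])
  then have y: "y < cos (real d * \<delta>)" using neg by (simp add: y_def)
  have "((\<lambda>e. cos (real d * (\<delta> + e))) \<longlongrightarrow> cos (real d * (\<delta> + 0))) (at_right 0)"
    by (intro tendsto_intros)
  then have 1: "\<forall>\<^sub>F e in at_right 0. y < cos (real d * (\<delta> + e))"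
    using y by (intro order_tendstoD(1)) auto
  have "((\<lambda>e. real d * (\<delta> + e)) \<longlongrightarrow> real d * (\<delta> + 0)) (at_right 0)"
    by (intro tendsto_intros)
  then have 2: "\<forall>\<^sub>F e in at_right 0. real d * (\<delta> + e) < pi / 2"
    using \<delta> by (intro order_tendstoD(2)) auto
  have "\<forall>\<^sub>F e in at_right (0::real). e > 0" by (simp add: eventually_at_right_less)
  with 1 2 have "\<forall>\<^sub>F e in at_right 0. y < cos (real d * (\<delta> + e)) \<and> real d * (\<delta> + e) < pi / 2 \<and> e > 0"
    by eventually_elim simp
  then obtain e where e: "y < cos (real d * (\<delta> + e))" "real d * (\<delta> + e) < pi / 2" "e > 0"
    by (metis (no_types, lifting) eventually_happens trivial_limit_at_right_real)
  \<comment> \<open>Shrinking \<open>p\<close> and shifting the cosine slightly to the left separates the double zero at \<open>\<theta>\<close>.\<close>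
  define s where "s = (1 + cos (real d * e)) / 2"
  have "real d * e < pi / 2" using e \<delta> by (simp add: algebra_simps)
      (smt (verit) mult_nonneg_nonneg of_nat_0_le_iff)
  moreover have "0 < real d * e" using e \<open>d > 0\<close> by simp
  ultimately have "cos (real d * e) < cos 0" "cos (real d * e) > 0"
    by (intro cos_monotone_0_pi cos_gt_zero; simp)+
  then have s: "0 < s" "s < 1" "cos (real d * e) < s" by (auto simp: s_def)
  \<comment> \<open>The cosine now peaks at \<open>\<theta> - e\<close>. At \<theta> it equals
    \<open>cos (real d * e)\<close>, which is less than \<open>s\<close>, the value of the scaled
    polynomial.\<close>
  have "poly (smult s p) (cos (\<theta> + \<delta>)) \<ge> cos (real d * (\<theta> + \<delta> - (\<theta> - e)))"
  proof (rule poly_cos_crosses_cos_once[where a = \<theta>])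
    show "\<bar>poly (smult s p) (cos t)\<bar> < 1" for t
    proof -
      have "s * \<bar>poly p (cos t)\<bar> \<le> s" using bound[of t] s by (intro mult_left_le) auto
      then have "s * \<bar>poly p (cos t)\<bar> < 1" using s(2) by (rule le_less_trans)
      then show ?thesis using s(1) by (simp add: abs_mult)
    qed
    have "real d * (\<delta> + e) < pi" using e(2) pi_gt_zero by linarith
    then show "\<theta> + \<delta> < \<theta> - e + pi / real d"
      using \<open>d > 0\<close> by (simp add: field_simps)
  qed (use deg top s e \<open>\<delta> > 0\<close> \<open>d > 0\<close> in auto)
  moreover have "s * poly p (cos (\<theta> + \<delta>)) \<le> y"
  proof -
    have "s * poly p (cos (\<theta> + \<delta>)) \<le> s * y" using s by (intro mult_left_mono) (auto simp: y_def)
    also have "\<dots> \<le> y" using s by (intro mult_left_le_one_le) (auto simp: y_def)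
    finally show ?thesis .
  qed
  ultimately show False using e(1) by (simp add: algebra_simps)
qed

text \<open>Evenness of the cosine reduces a point to the left of \<theta> to the one-sided case,
  run from \<open>- \<theta>\<close> to \<open>- \<phi>\<close>.\<close>

lemma Riesz_comparison:
  fixes p :: "real poly"
  assumes "degree p \<le> d" and "\<And>t. \<bar>poly p (cos t)\<bar> \<le> 1" and "poly p (cos \<theta>) = 1"
    and "real d * \<bar>\<phi> - \<theta>\<bar> < pi / 2"
  shows "poly p (cos \<phi>) \<ge> cos (real d * \<bar>\<phi> - \<theta>\<bar>)"
proof (cases "\<theta> \<le> \<phi>")
  case True
  then show ?thesis using Riesz_comparison_right[of p d \<theta> "\<phi> - \<theta>"] assms by simp
next
  case False
  then have "poly p (cos (- \<theta> + (\<theta> - \<phi>))) \<ge> cos (real d * (\<theta> - \<phi>))"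
    using assms by (intro Riesz_comparison_right) auto
  then show ?thesis using False by simp
qed

section \<open>Maximum norm of a polynomial from its values at the Chebyshev zeros\<close>

text \<open>The Chebyshev angles are the midpoints of \<open>L\<close> equal cells covering
  \<open>[0, pi]\<close>, so the distance is at most half a cell.\<close>

lemma near_chebyshev_angle:
  assumes "0 \<le> \<theta>" "\<theta> \<le> pi" "0 < L"
  obtains l where "l \<in> {1..L}" "\<bar>pi * (real l - 1/2) / real L - \<theta>\<bar> \<le> pi / (2 * real L)"
proof
  define t where "t = real L * \<theta> / pi"
  \<comment> \<open>The ceiling numbers the cell containing \<theta>; the maximum with 1 only
    matters at \<open>t = 0\<close>, whose ceiling is 0.\<close>
  define l where "l = max 1 (nat \<lceil>t\<rceil>)"
  have t: "0 \<le> t" "t \<le> real L" using assms by (auto simp: t_def field_simps)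
  then show "l \<in> {1..L}" using assms(3) by (auto simp: l_def ceiling_le_iff)
  have "\<bar>(real l - 1/2) - t\<bar> \<le> 1/2"
  proof (cases "t = 0")
    case False
    then have "\<lceil>t\<rceil> \<ge> 1" using t by (simp add: le_ceiling_iff)
    then have "real l = of_int \<lceil>t\<rceil>" by (simp add: l_def max_def) linarith
    then show ?thesis by linarith
  qed (simp add: l_def)
  moreover have "pi * (real l - 1/2) / real L - \<theta> = ((real l - 1/2) - t) * (pi / real L)"
    using assms(3) by (simp add: t_def field_simps)
  then have "\<bar>pi * (real l - 1/2) / real L - \<theta>\<bar> = \<bar>(real l - 1/2) - t\<bar> * (pi / real L)"
    by (simp add: abs_mult)
  ultimately show "\<bar>pi * (real l - 1/2) / real L - \<theta>\<bar> \<le> pi / (2 * real L)"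
    using mult_right_mono[of "\<bar>(real l - 1/2) - t\<bar>" "1/2" "pi / real L"] by simp
qed

text \<open>At the Chebyshev angle nearest to a maximum point, the comparison lemma retains at least
  the fraction \<open>cos (pi * d / (2 * L))\<close> of the maximum modulus; \<open>d < L\<close>
  keeps this angle below \<open>pi / 2\<close>.\<close>

lemma Ehlich_Zeller:
  fixes p :: "real poly"
  assumes deg: "degree p \<le> d" "d < L"
    and x: "x \<in> {-1..1}"
    and nodes: "\<And>l. l \<in> {1..L} \<Longrightarrow> \<bar>poly p (cos (pi * (real l - 1/2) / real L))\<bar> \<le> B"
  shows "\<bar>poly p x\<bar> \<le> inverse (cos (pi * real d / (2 * real L))) * B"
proof -
  obtain y where y: "y \<in> {-1..1}" "\<And>z. z \<in> {-1..1} \<Longrightarrow> \<bar>poly p z\<bar> \<le> \<bar>poly p y\<bar>"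
    using continuous_attains_sup[of "{-1..1::real}" "\<lambda>z. \<bar>poly p z\<bar>"]
    by (force intro: continuous_on_rabs continuous_on_poly continuous_on_id)
  have dL: "pi * real d / (2 * real L) < pi / 2" using deg(2) by (simp add: field_simps)
  have pos: "cos (pi * real d / (2 * real L)) > 0"
    using dL by (intro cos_gt_zero_pi) (auto intro: less_le_trans[of _ 0])
  have "\<bar>poly p y\<bar> * cos (pi * real d / (2 * real L)) \<le> B"
  proof (cases "poly p y = 0")
    case True
    then show ?thesis using nodes[of 1] deg(2) by auto
  next
    case False
    \<comment> \<open>Dividing by the signed value \<open>poly p y\<close> makes the maximum modulus
      1 and attained with a positive sign.\<close>
    define q where "q = smult (1 / poly p y) p"
    obtain l where l: "l \<in> {1..L}" "\<bar>pi * (real l - 1/2) / real L - arccos y\<bar> \<le> pi / (2 * real L)"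
      using near_chebyshev_angle[of "arccos y" L] y(1) deg(2) by (auto intro: arccos_lbound arccos_ubound)
    let ?t = "pi * (real l - 1/2) / real L"
    have le: "real d * \<bar>?t - arccos y\<bar> \<le> pi * real d / (2 * real L)"
      using mult_left_mono[OF l(2), of "real d"] by (simp add: mult.commute)
    have "cos (pi * real d / (2 * real L)) \<le> cos (real d * \<bar>?t - arccos y\<bar>)"
      proof (intro cos_monotone_0_pi_le)
      show "pi * real d / (2 * real L) \<le> pi" using dL pi_gt_zero by linarith
    qed (use le in auto)
    also have "\<dots> \<le> poly q (cos ?t)"
    proof (rule Riesz_comparison)
      show "\<bar>poly q (cos t)\<bar> \<le> 1" for t
        using y(2)[of "cos t"] False by (simp add: q_def abs_mult field_simps)
      show "poly q (cos (arccos y)) = 1" using y(1) False by (simp add: q_def cos_arccos)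
    qed (use deg(1) le dL in \<open>auto simp: q_def\<close>)
    also have "\<dots> \<le> \<bar>poly p (cos ?t)\<bar> / \<bar>poly p y\<bar>"
      by (simp add: q_def flip: abs_divide)
    also have "\<dots> \<le> B / \<bar>poly p y\<bar>" using nodes[OF l(1)] by (intro divide_right_mono) auto
    finally show ?thesis using False by (simp add: field_simps)
  qed
  then have "\<bar>poly p y\<bar> \<le> inverse (cos (pi * real d / (2 * real L))) * B"
    using pos by (simp add: field_simps)
  then show ?thesis using y(2)[OF x] by linarith
qed

section \<open>From biorthogonal matrices to projections\<close>

lemma apply_bcontfun_sum: "apply_bcontfun (\<Sum>i\<in>I. f i) x = (\<Sum>i\<in>I. apply_bcontfun (f i) x)"
  by (induction I rule: infinite_finite_induct) (auto simp: zero_bcontfun.rep_eq plus_bcontfun.rep_eq)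

lemma bounded_linear_apply_bcontfun: "bounded_linear (\<lambda>f. apply_bcontfun f x)"
  by (rule bounded_linear_intro[where K = 1])
    (auto simp: plus_bcontfun.rep_eq scaleR_bcontfun.rep_eq norm_bounded)

text \<open>Freezing the signs of the \<open>g k\<close> at \<open>x\<close> gives a single
  polynomial \<open>h\<close> in \<open>U\<close> that equals the sum of moduli at \<open>x\<close>
  and is dominated by it at every node.\<close>

lemma sum_abs_le_chebyshev_max:
  fixes g :: "'k \<Rightarrow> C_segment"
  assumes U: "subspace U" "\<And>f. f \<in> U \<Longrightarrow> polynomial_of_degree_le d f"
    and g: "\<And>k. k \<in> I \<Longrightarrow> g k \<in> U" and dL: "d < L"
  shows "(\<Sum>k\<in>I. \<bar>g k x\<bar>) \<le> inverse (cos (pi * real d / (2 * real L))) *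
    (MAX l\<in>{1..L}. \<Sum>k\<in>I. \<bar>g k (chebyshev_zero L l)\<bar>)"
proof -
  define h where "h = (\<Sum>k\<in>I. sgn (g k x) *\<^sub>R g k)"
  have h: "h z = (\<Sum>k\<in>I. sgn (g k x) * g k z)" for z
    by (simp add: h_def apply_bcontfun_sum scaleR_bcontfun.rep_eq)
  have "h \<in> U" unfolding h_def using g by (intro subspace_sum subspace_scale U(1))
  then obtain p where p: "degree p \<le> d" "\<And>z. h z = poly p (coord z)"
    using U(2) unfolding polynomial_of_degree_le_def by blast
  have "(\<Sum>k\<in>I. \<bar>g k x\<bar>) \<le> \<bar>h x\<bar>" 
    by (rule order.trans[OF _ abs_ge_self]) (simp add: h abs_sgn mult.commute)
  also have "\<dots> \<le> inverse (cos (pi * real d / (2 * real L))) *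
      (MAX l\<in>{1..L}. \<Sum>k\<in>I. \<bar>g k (chebyshev_zero L l)\<bar>)"
    unfolding p(2)
  proof (rule Ehlich_Zeller[OF p(1) dL coord])
    fix l assume l: "l \<in> {1..L}"
    have "\<bar>poly p (cos (pi * (real l - 1/2) / real L))\<bar> = \<bar>h (chebyshev_zero L l)\<bar>"
      by (simp add: p(2) coord_chebyshev_zero)
    also have "\<dots> \<le> (\<Sum>k\<in>I. \<bar>sgn (g k x) * g k (chebyshev_zero L l)\<bar>)" unfolding h by (rule sum_abs)
    also have "\<dots> \<le> (\<Sum>k\<in>I. \<bar>g k (chebyshev_zero L l)\<bar>)"
      by (intro sum_mono) (simp add: abs_mult abs_sgn_eq)
    also have "\<dots> \<le> (MAX l\<in>{1..L}. \<Sum>k\<in>I. \<bar>g k (chebyshev_zero L l)\<bar>)"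
      using l by (intro Max_ge) auto
    finally show "\<bar>poly p (cos (pi * (real l - 1/2) / real L))\<bar> \<le>
      (MAX l\<in>{1..L}. \<Sum>k\<in>I. \<bar>g k (chebyshev_zero L l)\<bar>)" .
  qed
  finally show ?thesis .
qed

lemma biorthogonal_projection:
  assumes basis: "is_basis M u U" and A: "A \<in> biorthogonal_matrices M K u v"
    and bound: "\<And>x. (\<Sum>k=1..K. \<bar>\<Sum>m=1..M. A m k * u m x\<bar>) \<le> B" and "0 \<le> B"
  obtains P where "is_projection_onto P U" "norm P \<le> B"
proof
  define g where "g k = (\<Sum>m=1..M. A m k *\<^sub>R u m)" for k
  have g: "g k x = (\<Sum>m=1..M. A m k * u m x)" for k x
    by (simp add: g_def apply_bcontfun_sum scaleR_bcontfun.rep_eq)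
  define P :: "C_segment \<Rightarrow>\<^sub>L C_segment" where "P = Blinfun (\<lambda>f. \<Sum>k=1..K. apply_bcontfun f (v k) *\<^sub>R g k)"
  have P: "blinfun_apply P f = (\<Sum>k=1..K. f (v k) *\<^sub>R g k)" for f
    unfolding P_def
    by (subst bounded_linear_Blinfun_apply)
      (auto intro!: bounded_linear_sum bounded_linear_scaleR_const bounded_linear_apply_bcontfun)
  have span: "span (u ` {1..M}) = U" using basis by (simp add: is_basis_def)
  then have sub: "subspace U" by auto
  have gU: "g k \<in> U" for k
    unfolding g_def span[symmetric] by (intro span_sum span_scale span_base) auto
  have fix_basis: "blinfun_apply P (u n) = u n" if n: "n \<in> {1..M}" for n
  proof -
    have "blinfun_apply P (u n) = (\<Sum>k=1..K. \<Sum>m=1..M. (A m k * u n (v k)) *\<^sub>R u m)"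
      by (simp add: P g_def scaleR_sum_right mult.commute)
    \<comment> \<open>After the swap, the coefficient of \<open>u m\<close> is exactly the left side
      of the biorthogonality condition for \<open>m\<close> and \<open>n\<close>.\<close>
    also have "\<dots> = (\<Sum>m=1..M. (\<Sum>k=1..K. A m k * u n (v k)) *\<^sub>R u m)"
      by (subst sum.swap) (simp add: scaleR_sum_left)
    also have "\<dots> = (\<Sum>m=1..M. if m = n then u m else 0)"
      using A n by (intro sum.cong) (auto simp: biorthogonal_matrices_def)
    also have "\<dots> = u n" using n by simp
    finally show ?thesis .
  qed
  have fix_U: "blinfun_apply P f = f" if "f \<in> U" for f
    using that unfolding span[symmetric]
    by (rule linear_eq_on_span[where g = "\<lambda>x. x", rotated 3])
      (auto simp: fix_basis blinfun.bounded_linear_right bounded_linear.linear linear_ident)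
  have "blinfun_apply P f \<in> U" for f
    unfolding P by (intro subspace_sum subspace_scale sub gU)
  then show "is_projection_onto P U"
    unfolding is_projection_onto_def using fix_U by (metis image_subset_iff rangeI subsetI subset_antisym)
  show "norm P \<le> B"
  proof (rule norm_blinfun_bound[OF \<open>0 \<le> B\<close>], rule norm_bound)
    fix f x
    have "norm (blinfun_apply P f x) \<le> (\<Sum>k=1..K. \<bar>f (v k) * g k x\<bar>)"
      by (simp add: P apply_bcontfun_sum scaleR_bcontfun.rep_eq)
    also have "\<dots> \<le> (\<Sum>k=1..K. norm f * \<bar>g k x\<bar>)"
      using norm_bounded[of f] by (intro sum_mono) (auto simp: abs_mult intro!: mult_right_mono)
    also have "\<dots> = norm f * (\<Sum>k=1..K. \<bar>g k x\<bar>)" by (simp add: sum_distrib_left)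
    also have "\<dots> \<le> norm f * B"
      using bound[of x] unfolding g by (intro mult_left_mono) auto
    finally show "norm (blinfun_apply P f x) \<le> B * norm f" by (simp add: mult.commute)
  qed
qed

theorem proposition3:
  fixes d M K L :: nat
    and U :: "C_segment set"
    and u :: "nat \<Rightarrow> C_segment"
    and v :: "nat \<Rightarrow> segment"
    and \<rho> :: real
  assumes "subspace U" and "dim U = M"
    and "\<forall>f\<in>U. polynomial_of_degree_le d f"
    and "is_basis M u U"
    and "inj_on v {1..K}"
    and "L > d"
    and "\<rho> = inverse (cos (pi * real d / (2 * real L)))"
  shows "projection_constant U \<le> ereal \<rho> *
    (INF A\<in>biorthogonal_matrices M K u v.
      ereal (MAX l\<in>{1..L}. \<Sum>k=1..K. \<bar>\<Sum>m=1..M. A m k * u m (chebyshev_zero L l)\<bar>))"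
proof -
  have \<rho>: "\<rho> \<ge> 1" using inverse_cos_ge_1[OF assms(6)] assms(7) by simp
  let ?N = "\<lambda>A. MAX l\<in>{1..L}. \<Sum>k=1..K. \<bar>\<Sum>m=1..M. A m k * u m (chebyshev_zero L l)\<bar>"
  have main: "projection_constant U \<le> ereal (\<rho> * ?N A)" if A: "A \<in> biorthogonal_matrices M K u v" for A
  proof -
    define g where "g k = (\<Sum>m=1..M. A m k *\<^sub>R u m)" for k
    have g: "g k x = (\<Sum>m=1..M. A m k * u m x)" for k x
      by (simp add: g_def apply_bcontfun_sum scaleR_bcontfun.rep_eq)
    have gU: "g k \<in> U" for k
      using assms(4) unfolding g_def is_basis_def
      by (auto intro!: span_sum span_scale intro: span_base)
    have le: "(\<Sum>k=1..K. \<bar>\<Sum>m=1..M. A m k * u m x\<bar>) \<le> \<rho> * ?N A" for x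
      using sum_abs_le_chebyshev_max[of U d "{1..K}" g L x] assms gU by (simp add: g)
    then have "0 \<le> \<rho> * ?N A"
      by (rule order.trans[rotated]) (intro sum_nonneg abs_ge_zero)
    then obtain P where "is_projection_onto P U" "norm P \<le> \<rho> * ?N A"
      using biorthogonal_projection[OF assms(4) A le] by blast
    then show ?thesis
      unfolding projection_constant_def by (intro INF_lower2[of P]) auto
  qed
  \<comment> \<open>With the positive finite \<rho> moved to the left, the claim is that a lower
    bound of all members is below the infimum; this includes the empty family, whose infimum is
    infinite.\<close>
  have "projection_constant U / ereal \<rho> \<le> (INF A\<in>biorthogonal_matrices M K u v. ereal (?N A))"
    using main \<rho> by (intro INF_greatest) (simp add: ereal_divide_le_pos)
  then show ?thesis using \<rho> by (simp add: ereal_divide_le_pos)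
qed

end
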